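(* Let $\mathcal{C}$ be a tropical variety of dimension $k$ in $\mathbb{R}^n$, with support $|\mathcal{C}|\subseteq\mathbb{R}^n$. Then the complement $\mathbb{R}^n\setminus|\mathcal{C}|$ is locally $(n-k)$-convex.
   Context: **Tropical varieties.** A polyhedron in $\mathbb{R}^n$ is rational if it is a finite intersection of closed half-spaces whose normal vectors are rational; its directions are then spanned by integer vectors. For a rational polyhedron $\sigma$, let $\mathrm{Aff}(\sigma)$ be its affine span and $H_\sigma$ the linear subspace obtained by translating $\mathrm{Aff}(\sigma)$ to the origin. If $\tau$ is a codimension one face of a $p$-dimensional rational polyhedron $\sigma$, let $u_{\sigma/\tau}$ be the unique generator of the rank one lattice $(H_\sigma\cap\mathbb{Z}^n)/(H_\tau\cap\mathbb{Z}^n)$ that points from $\tau$ in the direction of $\sigma$. A $p$-dimensional weighted complex $\mathcal{C}$ is a rational polyhedral complex in $\mathbb{R}^n$, all of whose inclusion-maximal cells have dimension $p$, together with a real weight $w_{\mathcal{C}}(\sigma)$ for each $p$-dimensional cell $\sigma$. It is balanced if for every $(p-1)$-dimensional cell $\tau$ one has $\sum_{\sigma\supset\tau} w_{\mathcal{C}}(\sigma)\,u_{\sigma/\tau}=0$ in $\mathbb{Z}^n/(H_\tau\cap\mathbb{Z}^n)$ (tensored with $\mathbb{R}$ if weights are not integers), the sum being over all $p$-dimensional cells $\sigma$ of $\mathcal{C}$ containing $\tau$ as a face. A tropical variety of dimension $p$ is a balanced $p$-dimensional weighted complex with finitely many cells and with all weights positive. Its support $|\mathcal{C}|$ is the union of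 its cells; the complement of a tropical variety means the complement of its support. **Supporting caps.** Let $A\subseteq\mathbb{R}^n$. An open round disk $B\subseteq L$ of radius $\delta>0$ in an affine $m$-plane $L\subseteq\mathbb{R}^n$ is a supporting $m$-cap for $A$ if (i) $B\cap A$ is nonempty and compact, and (ii) there is a vector $v\in\mathbb{R}^n$ such that the translate $B+\epsilon v$ is disjoint from $A$ for all sufficiently small $\epsilon>0$. **Local convexity.** A subset $X\subseteq\mathbb{R}^n$ is locally $m$-convex if $A=\mathbb{R}^n\setminus X$ has no supporting $m$-caps. *)

theory Defs
  imports "HOL-Analysis.Analysis"
begin

section \<open>Rational polyhedra and their lattices\<close>

text \<open>Only the normal vectors are required to be rational; the offsets are arbitrary reals.\<close>

definition rational_polyhedron :: "(real ^ 'n) set \<Rightarrow> bool" where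
  "rational_polyhedron \<sigma> \<longleftrightarrow>
     (\<exists>F. finite F \<and> \<sigma> = \<Inter>F \<and>
          (\<forall>h\<in>F. \<exists>a b. a \<noteq> 0 \<and> (\<forall>i. a $ i \<in> \<rat>) \<and> h = {x. a \<bullet> x \<le> b}))"

definition direction_space :: "(real ^ 'n) set \<Rightarrow> (real ^ 'n) set" where
  "direction_space \<sigma> = {x - y | x y. x \<in> affine hull \<sigma> \<and> y \<in> affine hull \<sigma>}"

definition cell_lattice :: "(real ^ 'n) set \<Rightarrow> (real ^ 'n) set" where
  "cell_lattice \<sigma> = direction_space \<sigma> \<inter> {z. \<forall>i. z $ i \<in> \<int>}"

text \<open>
  For a codimension one face \<open>\<tau>\<close> of \<open>\<sigma>\<close>, the vector \<open>u\<close> represents the generator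
  of \<open>cell_lattice \<sigma> / cell_lattice \<tau>\<close> that points from \<open>\<tau>\<close> towards \<open>\<sigma>\<close>: modulo
  \<open>direction_space \<tau>\<close> it is a positive multiple of a vector leading from a point of \<open>\<tau>\<close>
  to a point of \<open>\<sigma>\<close>. (As a generator of a rank one group, \<open>u\<close> is not in
  \<open>direction_space \<tau>\<close>, so the latter point is not in \<open>\<tau>\<close>.)
\<close>

definition represents_primitive_normal ::
    "(real ^ 'n) set \<Rightarrow> (real ^ 'n) set \<Rightarrow> real ^ 'n \<Rightarrow> bool" where
  "represents_primitive_normal \<sigma> \<tau> u \<longleftrightarrow>
     u \<in> cell_lattice \<sigma> \<and>
     (\<forall>z\<in>cell_lattice \<sigma>. \<exists>c::int. z - of_int c *\<^sub>R u \<in> cell_lattice \<tau>) \<and>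
     (\<exists>x\<in>\<tau>. \<exists>y\<in>\<sigma>. \<exists>c>0. u - c *\<^sub>R (y - x) \<in> direction_space \<tau>)"

text \<open>
  For a codimension one face of a rational polyhedron such a \<open>u\<close> exists and is unique modulo
  \<open>cell_lattice \<tau>\<close>. The choice of the representative is irrelevant below, where
  \<open>primitive_normal\<close> is only used modulo the span of \<open>cell_lattice \<tau>\<close>.
\<close>

definition primitive_normal :: "(real ^ 'n) set \<Rightarrow> (real ^ 'n) set \<Rightarrow> real ^ 'n" where
  "primitive_normal \<sigma> \<tau> = (SOME u. represents_primitive_normal \<sigma> \<tau> u)"

section \<open>Tropical varieties\<close>

text \<open>Cells are nonempty. The empty intersection of two cells is admitted, since \<open>{} face_of S\<close>
  holds for every \<open>S\<close>.\<close>

definition rational_polyhedral_complex :: "(real ^ 'n) set set \<Rightarrow> bool" where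
  "rational_polyhedral_complex C \<longleftrightarrow>
     (\<forall>\<sigma>\<in>C. rational_polyhedron \<sigma> \<and> \<sigma> \<noteq> {}) \<and>
     (\<forall>\<sigma>\<in>C. \<forall>\<tau>. \<tau> face_of \<sigma> \<and> \<tau> \<noteq> {} \<longrightarrow> \<tau> \<in> C) \<and>
     (\<forall>\<sigma>\<in>C. \<forall>\<tau>\<in>C. \<sigma> \<inter> \<tau> face_of \<sigma> \<and> \<sigma> \<inter> \<tau> face_of \<tau>)"

definition pure_complex :: "nat \<Rightarrow> (real ^ 'n) set set \<Rightarrow> bool" where
  "pure_complex p C \<longleftrightarrow>
     rational_polyhedral_complex C \<and>
     (\<forall>\<sigma>\<in>C. (\<forall>\<rho>\<in>C. \<sigma> \<subseteq> \<rho> \<longrightarrow> \<rho> = \<sigma>) \<longrightarrow> aff_dim \<sigma> = int p)"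

text \<open>
  The balancing condition lives in the quotient of the integer lattice by \<open>cell_lattice \<tau>\<close>,
  tensored with the reals. This is the quotient of the whole space by
  \<open>span (cell_lattice \<tau>)\<close>, so a sum vanishes there iff it lies in that span.
  Weights are only relevant on cells of dimension \<open>p\<close>. Note that the sum is only meaningful
  for finite \<open>C\<close>.
\<close>

definition balanced :: "nat \<Rightarrow> (real ^ 'n) set set \<Rightarrow> ((real ^ 'n) set \<Rightarrow> real) \<Rightarrow> bool" where
  "balanced p C w \<longleftrightarrow>
     (\<forall>\<tau>\<in>C. aff_dim \<tau> = int p - 1 \<longrightarrow>
        (\<Sum>\<sigma> | \<sigma> \<in> C \<and> aff_dim \<sigma> = int p \<and> \<tau> face_of \<sigma>. w \<sigma> *\<^sub>R primitive_normal \<sigma> \<tau>)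
          \<in> span (cell_lattice \<tau>))"

definition tropical_variety ::
    "nat \<Rightarrow> (real ^ 'n) set set \<Rightarrow> ((real ^ 'n) set \<Rightarrow> real) \<Rightarrow> bool" where
  "tropical_variety p C w \<longleftrightarrow>
     finite C \<and> pure_complex p C \<and> balanced p C w \<and>
     (\<forall>\<sigma>\<in>C. aff_dim \<sigma> = int p \<longrightarrow> w \<sigma> > 0)"

section \<open>Supporting caps and local convexity\<close>

definition supporting_cap :: "nat \<Rightarrow> (real ^ 'n) set \<Rightarrow> (real ^ 'n) set \<Rightarrow> bool" where
  "supporting_cap m A B \<longleftrightarrow>
     (\<exists>L c \<delta>. affine L \<and> aff_dim L = int m \<and> c \<in> L \<and> \<delta> > 0 \<and> B = ball c \<delta> \<inter> L) \<and>
     B \<inter> A \<noteq> {} \<and> compact (B \<inter> A) \<and>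
     (\<exists>v. \<forall>\<^sub>F \<epsilon> in at_right 0. (\<lambda>x. x + \<epsilon> *\<^sub>R v) ` B \<inter> A = {})"

definition locally_m_convex :: "nat \<Rightarrow> (real ^ 'n) set \<Rightarrow> bool" where
  "locally_m_convex m X \<longleftrightarrow> \<not> (\<exists>B. supporting_cap m (- X) B)"

end

theory Submission
  imports Defs
begin

text \<open>
  Suppose a disk \<open>B\<close> were a supporting cap. The intersection of \<open>B\<close> with the variety is compact,
  so the rim of \<open>B\<close> and its final translate keep a positive distance from the variety, and
  the plane of \<open>B\<close> can be perturbed to be transverse to all top-dimensional cells, with \<open>B\<close> still
  passing through a relative interior point of one of them and the translation direction generic,
  so that the moving disk avoids all cells of codimension two or more after time \<open>0\<close>.
  The times at which the disk meets the variety then form a closed set. No such time is the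
  last one: near a relative interior point of a top-dimensional cell this is
  transversality, and near one of a codimension one cell balancing with positive weights
  provides an adjacent cell on the side towards which the disk moves. But the final translate misses the variety.
\<close>

section \<open>Direction spaces\<close>

lemma direction_space_eq:
  assumes "a \<in> affine hull S"
  shows "direction_space S = (\<lambda>x. - a + x) ` (affine hull S)"
proof
  show "direction_space S \<subseteq> (\<lambda>x. - a + x) ` (affine hull S)"
  proof
    fix z assume "z \<in> direction_space S"
    then obtain x y where z: "z = x - y" "x \<in> affine hull S" "y \<in> affine hull S"
      by (auto simp: direction_space_def)
    have "a + 1 *\<^sub>R (x - y) \<in> affine hull S"
      using assms z by (intro mem_affine_3_minus affine_affine_hull)
    then show "z \<in> (\<lambda>x. - a + x) ` (affine hull S)"
      using z(1) by (intro image_eqI[of _ _ "a + z"]) auto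
  qed
  show "(\<lambda>x. - a + x) ` (affine hull S) \<subseteq> direction_space S"
    using assms unfolding direction_space_def by force
qed

lemma subspace_direction_space:
  assumes "S \<noteq> {}"
  shows "subspace (direction_space S)"
proof -
  obtain a where "a \<in> affine hull S" using assms hull_inc by fastforce
  then show ?thesis
    using affine_diffs_subspace[of "affine hull S" a] by (simp add: direction_space_eq)
qed

lemma dim_direction_space:
  assumes "S \<noteq> {}"
  shows "int (dim (direction_space S)) = aff_dim S"
proof -
  obtain a where a: "a \<in> affine hull S" using assms hull_inc by fastforce
  then have "aff_dim (affine hull S) = int (dim ((\<lambda>x. - a + x) ` (affine hull S)))"
    by (intro aff_dim_eq_dim) (simp add: hull_hull)
  then show ?thesis using a by (simp add: direction_space_eq)
qed

lemma direction_space_mono: "S \<subseteq> T \<Longrightarrow> direction_space S \<subseteq> direction_space T"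
  unfolding direction_space_def using hull_mono[of S T affine] by blast

lemma diff_in_direction_space: "x \<in> S \<Longrightarrow> y \<in> S \<Longrightarrow> x - y \<in> direction_space S"
  unfolding direction_space_def using hull_inc[of _ S affine] by blast

lemma eventually_scaled_in_ball:
  fixes d :: "'a::real_normed_vector"
  assumes "e > 0"
  shows "\<forall>\<^sub>F t in at_right (0::real). norm (t *\<^sub>R d) < e"
proof -
  have "((\<lambda>t. norm (t *\<^sub>R d)) \<longlongrightarrow> norm ((0::real) *\<^sub>R d)) (at_right 0)"
    by (intro tendsto_intros)
  then show ?thesis using assms by (intro order_tendstoD) auto
qed

lemma eventually_in_of_rel_interior:
  assumes "q \<in> rel_interior S" "d \<in> direction_space S"
  shows "\<forall>\<^sub>F t in at_right (0::real). q + t *\<^sub>R d \<in> S"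
proof -
  obtain e where e: "q \<in> S" "e > 0" "ball q e \<inter> affine hull S \<subseteq> S"
    using assms(1) by (auto simp: mem_rel_interior_ball)
  have aff: "q + t *\<^sub>R d \<in> affine hull S" for t
  proof -
    obtain x y where "d = x - y" "x \<in> affine hull S" "y \<in> affine hull S"
      using assms(2) by (auto simp: direction_space_def)
    then show ?thesis
      using mem_affine_3_minus[OF affine_affine_hull hull_inc[OF e(1)]] by simp
  qed
  show ?thesis
    using eventually_scaled_in_ball[OF e(2), of d]
  proof eventually_elim
    case (elim t)
    then have "q + t *\<^sub>R d \<in> ball q e" by (simp add: dist_norm)
    then show ?case using aff e(3) by blast
  qed
qed

section \<open>Primitive normals\<close>

lemma rational_imp_integer_multiple:
  fixes a :: "real ^ 'n"
  assumes "\<And>i. a $ i \<in> \<rat>"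
  obtains N :: real where "N > 0" "\<And>i. (N *\<^sub>R a) $ i \<in> \<int>"
proof -
  have "\<exists>m::nat. m > 0 \<and> real m * a $ i \<in> \<int>" for i
  proof -
    obtain p :: int and n :: nat where "n \<noteq> 0" "a $ i = of_int p / of_nat n"
      using assms[of i] unfolding Rats_eq_int_div_nat by auto
    then show ?thesis by (intro exI[of _ n]) auto
  qed
  then obtain m :: "'n \<Rightarrow> nat" where m: "\<And>i. m i > 0" "\<And>i. real (m i) * a $ i \<in> \<int>"
    by metis
  have "real (\<Prod>j\<in>UNIV. m j) * a $ i \<in> \<int>" for i
  proof -
    have "real (\<Prod>j\<in>UNIV. m j) * a $ i = real (\<Prod>j\<in>UNIV - {i}. m j) * (real (m i) * a $ i)"
      by (subst prod.remove[of UNIV i]) auto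
    then show ?thesis using m(2)[of i] by (metis Ints_mult Ints_of_nat)
  qed
  moreover have "real (\<Prod>j\<in>UNIV. m j) > 0" using m(1) by (simp add: prod_pos)
  ultimately show ?thesis using that by simp
qed

lemma rational_inner:
  fixes a b :: "real ^ 'n"
  assumes "\<And>i. a $ i \<in> \<rat>" "\<And>i. b $ i \<in> \<rat>"
  shows "a \<bullet> b \<in> \<rat>"
  unfolding inner_vec_def using assms by (auto intro!: Rats_sum Rats_mult)

text \<open>Rational equations preserve being spanned by rational vectors: correct the other
  generators by a rational multiple of one violating the new equation.\<close>

lemma rational_subspace_spanned:
  fixes J :: "(real ^ 'n) set"
  assumes "finite J" "\<forall>a\<in>J. \<forall>i. a $ i \<in> \<rat>"
  shows "{x. \<forall>a\<in>J. a \<bullet> x = 0} \<subseteq> span {x. (\<forall>a\<in>J. a \<bullet> x = 0) \<and> (\<forall>i. x $ i \<in> \<rat>)}"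
  using assms
proof (induction J)
  case empty
  have "x \<in> span {x. \<forall>i. x $ i \<in> \<rat>}" for x :: "real ^ 'n"
  proof -
    have "x = (\<Sum>i\<in>UNIV. x $ i *\<^sub>R axis i 1)"
      using basis_expansion[of x] by (simp add: scalar_mult_eq_scaleR)
    also have "\<dots> \<in> span {x. \<forall>i. x $ i \<in> \<rat>}"
      by (intro span_sum span_scale span_base) (auto simp: axis_def)
    finally show ?thesis .
  qed
  then show ?case by auto
next
  case (insert a J)
  let ?R = "\<lambda>J. {x. (\<forall>a\<in>J. a \<bullet> x = 0) \<and> (\<forall>i. x $ i \<in> \<rat>)}"
  have IH: "{x. \<forall>a\<in>J. a \<bullet> x = 0} \<subseteq> span (?R J)"
    using insert by blast
  show ?case
  proof (cases "\<exists>s\<in>?R J. a \<bullet> s \<noteq> 0")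
    case False
    then have "?R (insert a J) = ?R J" by auto
    then show ?thesis using IH by auto
  next
    case True
    then obtain s where s: "s \<in> ?R J" "a \<bullet> s \<noteq> 0" by blast
    define f where "f = (\<lambda>x. x - ((a \<bullet> x) / (a \<bullet> s)) *\<^sub>R s)"
    have lin: "linear f"
      unfolding f_def
      by (rule linearI) (auto simp: algebra_simps inner_add_right add_divide_distrib)
    have "f ` ?R J \<subseteq> ?R (insert a J)"
    proof
      fix y assume "y \<in> f ` ?R J"
      then obtain x where x: "x \<in> ?R J" "y = f x" by blast
      have c: "(a \<bullet> x) / (a \<bullet> s) \<in> \<rat>"
        using x s insert.prems by (intro Rats_divide rational_inner) auto
      have "y $ i \<in> \<rat>" for i
        unfolding x(2) f_def vector_minus_component vector_scaleR_component real_scaleR_def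
        using x s by (intro Rats_diff Rats_mult c) auto
      then show "y \<in> ?R (insert a J)"
        using x s by (auto simp: f_def inner_diff_right)
    qed
    then have sub: "f ` span (?R J) \<subseteq> span (?R (insert a J))"
      unfolding linear_span_image[OF lin, symmetric] by (rule span_mono)
    show ?thesis
    proof
      fix x assume x: "x \<in> {x. \<forall>a\<in>insert a J. a \<bullet> x = 0}"
      then have "x = f x" by (simp add: f_def)
      moreover have "x \<in> span (?R J)" using x IH by auto
      ultimately show "x \<in> span (?R (insert a J))" using sub by blast
    qed
  qed
qed

text \<open>\<open>J\<close> collects the normals of the constraints tight at \<open>q\<close>.
  Short moves from \<open>q\<close> in both senses within \<tau> force them to vanish on its
  directions. Conversely, slack constraints survive a short move, and the face property pulls the
  moved points into \<tau>. The last conjunct, that these normals point out of \<sigma>, fixes a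
  sign later.\<close>

lemma rational_face_direction_space:
  fixes \<sigma> \<tau> :: "(real ^ 'n) set"
  assumes "rational_polyhedron \<sigma>" "\<tau> face_of \<sigma>" "q \<in> rel_interior \<tau>"
  shows "\<exists>J. finite J \<and> (\<forall>a\<in>J. \<forall>i. a $ i \<in> \<rat>) \<and>
    direction_space \<tau> = {x. \<forall>a\<in>J. a \<bullet> x = 0} \<and> (\<forall>a\<in>J. \<forall>y\<in>\<sigma>. a \<bullet> y \<le> a \<bullet> q)"
proof -
  obtain F where F: "finite F" "\<sigma> = \<Inter>F"
    "\<forall>h\<in>F. \<exists>a b. a \<noteq> 0 \<and> (\<forall>i. a $ i \<in> \<rat>) \<and> h = {x. a \<bullet> x \<le> b}"
    using assms(1) unfolding rational_polyhedron_def by blast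
  then obtain a b where ab: "\<And>h i. h \<in> F \<Longrightarrow> a h $ i \<in> \<rat>" "\<And>h. h \<in> F \<Longrightarrow> h = {x. a h \<bullet> x \<le> b h}"
    by metis
  have mem: "x \<in> \<sigma> \<longleftrightarrow> (\<forall>h\<in>F. a h \<bullet> x \<le> b h)" for x
    using ab(2) F(2) by blast
  have q: "q \<in> \<tau>" "q \<in> \<sigma>" using assms rel_interior_subset face_of_imp_subset by blast+
  define I where "I = {h\<in>F. a h \<bullet> q = b h}"
  have sub\<tau>: "\<tau> \<subseteq> \<sigma>" using assms(2) face_of_imp_subset by blast
  have eq: "direction_space \<tau> = {x. \<forall>c\<in>a ` I. c \<bullet> x = 0}"
  proof (intro equalityI subsetI)
    fix d assume d: "d \<in> direction_space \<tau>"
    \<comment> \<open>\<open>d\<close> is quantified afresh so that the bound applies to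
      \<open>- d\<close> too, which turns it into an equality.\<close>
    have "a h \<bullet> d \<le> 0" if h: "h \<in> I" and d: "d \<in> direction_space \<tau>" for h d
    proof -
      obtain t where "t > 0" "q + t *\<^sub>R d \<in> \<tau>"
        using eventually_happens'[OF _ eventually_conj[OF eventually_at_right_less[of 0]
            eventually_in_of_rel_interior[OF assms(3) d]]] by auto
      then have "a h \<bullet> (q + t *\<^sub>R d) \<le> b h" using mem sub\<tau> h by (auto simp: I_def)
      then show ?thesis using h \<open>t > 0\<close> by (simp add: I_def inner_add_right mult_le_0_iff)
    qed
    from this[OF _ d] this[of _ "- d"] d show "d \<in> {x. \<forall>c\<in>a ` I. c \<bullet> x = 0}"
      using subspace_neg[OF subspace_direction_space[of \<tau>]] q(1) by force
  next
    fix d assume d: "d \<in> {x. \<forall>c\<in>a ` I. c \<bullet> x = 0}"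
    have ev: "\<forall>\<^sub>F t in at_right (0::real). q + t *\<^sub>R d \<in> \<sigma>" if d: "\<forall>h\<in>I. a h \<bullet> d = 0" for d
    proof -
      have "\<forall>\<^sub>F t in at_right (0::real). \<forall>h\<in>F. a h \<bullet> (q + t *\<^sub>R d) \<le> b h"
      proof (intro eventually_ball_finite F(1) ballI)
        fix h assume h: "h \<in> F"
        show "\<forall>\<^sub>F t in at_right (0::real). a h \<bullet> (q + t *\<^sub>R d) \<le> b h"
        proof (cases "h \<in> I")
          case True
          then show ?thesis using d by (simp add: inner_add_right I_def)
        next
          case False
          then have "a h \<bullet> q < b h" using h mem q by (force simp: I_def)
          moreover have "((\<lambda>t. a h \<bullet> (q + t *\<^sub>R d)) \<longlongrightarrow> a h \<bullet> (q + 0 *\<^sub>R d)) (at_right (0::real))"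
            by (intro tendsto_intros)
          ultimately have "\<forall>\<^sub>F t in at_right (0::real). a h \<bullet> (q + t *\<^sub>R d) < b h"
            by (intro order_tendstoD) auto
          then show ?thesis by eventually_elim simp
        qed
      qed
      then show ?thesis by (simp add: mem)
    qed
    have "\<forall>\<^sub>F t in at_right (0::real). 0 < t \<and> q + t *\<^sub>R d \<in> \<sigma> \<and> q + t *\<^sub>R (- d) \<in> \<sigma>"
      using d by (intro eventually_conj eventually_at_right_less ev) auto
    then obtain t where t: "t > 0" "q + t *\<^sub>R d \<in> \<sigma>" "q + t *\<^sub>R (- d) \<in> \<sigma>"
      using eventually_happens'[OF trivial_limit_at_right_real] by blast
    have "q + t *\<^sub>R d \<in> \<tau>"
    proof (cases "d = 0")
      case False
      then have "q \<in> open_segment (q + t *\<^sub>R d) (q + t *\<^sub>R (- d))"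
        using t(1) by (auto simp: in_segment algebra_simps scaleR_2[symmetric] intro!: exI[of _ "1/2"])
      then show ?thesis using face_ofD[OF assms(2) _ t(2,3)] q by blast
    qed (use q in simp)
    then have "t *\<^sub>R d \<in> direction_space \<tau>"
      using diff_in_direction_space[of "q + t *\<^sub>R d" \<tau> q] q by simp
    then have "(1 / t) *\<^sub>R (t *\<^sub>R d) \<in> direction_space \<tau>"
      using subspace_scale[OF subspace_direction_space[of \<tau>]] q(1) by blast
    then show "d \<in> direction_space \<tau>" using t(1) by simp
  qed
  show ?thesis
    by (rule exI[of _ "a ` I"]) (use F(1) ab(1) mem eq in \<open>auto simp: I_def\<close>)
qed

text \<open>An integral functional \<open>g\<close> is built that takes integer values on
  \<open>cell_lattice \<sigma>\<close>, with kernel \<open>cell_lattice \<tau>\<close>. A lattice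
  vector with the least positive value then generates the quotient, by division with
  remainder.\<close>

lemma represents_primitive_normal_exists:
  fixes \<sigma> \<tau> :: "(real ^ 'n) set"
  assumes "rational_polyhedron \<sigma>" "\<tau> face_of \<sigma>" "\<tau> \<noteq> {}" "aff_dim \<tau> = aff_dim \<sigma> - 1"
  shows "\<exists>u. represents_primitive_normal \<sigma> \<tau> u \<and> u \<notin> direction_space \<tau>"
proof -
  let ?H = "direction_space \<sigma>" and ?T = "direction_space \<tau>"
  have sub: "\<tau> \<subseteq> \<sigma>" and cvx: "convex \<tau>" and ne: "\<sigma> \<noteq> {}"
    using assms face_of_imp_subset face_of_imp_convex by auto
  have conv\<sigma>: "convex \<sigma>"
    using assms(1) unfolding rational_polyhedron_def
    by (auto intro!: convex_Inter) (metis convex_halfspace_le)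
  obtain q where q: "q \<in> rel_interior \<tau>" using cvx assms(3) rel_interior_eq_empty by blast
  then have q\<tau>: "q \<in> \<tau>" using rel_interior_subset by blast
  obtain J where J: "finite J" "\<forall>a\<in>J. \<forall>i. a $ i \<in> \<rat>" "?T = {x. \<forall>a\<in>J. a \<bullet> x = 0}"
    "\<forall>a\<in>J. \<forall>y\<in>\<sigma>. a \<bullet> y \<le> a \<bullet> q"
    using rational_face_direction_space[OF assms(1,2) q] by blast
  obtain q' where q': "q' \<in> rel_interior \<sigma>" using conv\<sigma> ne rel_interior_eq_empty by blast
  obtain K where K: "finite K" "\<forall>a\<in>K. \<forall>i. a $ i \<in> \<rat>" "?H = {x. \<forall>a\<in>K. a \<bullet> x = 0}"
    using rational_face_direction_space[OF assms(1) face_of_refl[OF conv\<sigma>] q'] by blast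
  have subH: "subspace ?H" and subT: "subspace ?T"
    using ne assms(3) subspace_direction_space by auto
  have TH: "?T \<subseteq> ?H" using sub direction_space_mono by blast
  have dims: "dim ?H = Suc (dim ?T)"
    using dim_direction_space[OF ne] dim_direction_space[OF assms(3)] assms(4) by linarith
  then have "\<not> ?H \<subseteq> ?T" using dim_subset[of ?H ?T] by linarith
  then obtain a z0 where a: "a \<in> J" "z0 \<in> ?H" "a \<bullet> z0 \<noteq> 0" using J(3) by auto
  obtain N where N: "N > 0" "\<And>i. (N *\<^sub>R a) $ i \<in> \<int>"
    using rational_imp_integer_multiple J(2) a(1) by blast
  \<comment> \<open>The normal \<open>a\<close> points out of \<sigma>, so the minus sign makes
    \<open>g\<close> nonnegative on \<open>y - q\<close> for \<open>y\<close> in \<sigma>. The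
    factor \<open>N\<close> clears denominators.\<close>
  define g where "g = (- N) *\<^sub>R a"
  have g_int: "g $ i \<in> \<int>" for i using N(2)[of i] by (simp add: g_def)
  have gT: "g \<bullet> x = 0" if "x \<in> ?T" for x using that J(3) a(1) by (simp add: g_def)
  have T_eq: "?T = {x \<in> ?H. g \<bullet> x = 0}"
  proof (rule subspace_dim_equal)
    show sub1: "subspace {x \<in> ?H. g \<bullet> x = 0}"
      using subH by (auto simp: subspace_def inner_add_right)
    show "?T \<subseteq> {x \<in> ?H. g \<bullet> x = 0}" using TH gT by auto
    have "z0 \<notin> {x \<in> ?H. g \<bullet> x = 0}" using a N(1) by (simp add: g_def)
    then have "{x \<in> ?H. g \<bullet> x = 0} \<subset> ?H" using a(2) by blast
    then have "dim {x \<in> ?H. g \<bullet> x = 0} < dim ?H"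
      using sub1 subH by (metis dim_psubset span_eq_iff)
    then show "dim ?T \<ge> dim {x \<in> ?H. g \<bullet> x = 0}" using dims by linarith
  qed (rule subT)
  \<comment> \<open>Rational directions of \<sigma> span all its directions and become lattice
    vectors once denominators are cleared. If \<open>g\<close> vanished on the lattice, it would
    thus vanish at \<open>z0\<close>.\<close>
  have "\<exists>z\<in>cell_lattice \<sigma>. g \<bullet> z \<noteq> 0"
  proof (rule ccontr)
    assume neg: "\<not> (\<exists>z\<in>cell_lattice \<sigma>. g \<bullet> z \<noteq> 0)"
    have "g \<bullet> x = 0" if x: "(\<forall>a\<in>K. a \<bullet> x = 0)" "\<forall>i. x $ i \<in> \<rat>" for x
    proof -
      obtain M where M: "M > 0" "\<And>i. (M *\<^sub>R x) $ i \<in> \<int>"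
        using rational_imp_integer_multiple x(2) by blast
      have "M *\<^sub>R x \<in> cell_lattice \<sigma>"
        using M x K(3) unfolding cell_lattice_def by auto
      then show ?thesis using neg M(1) by force
    qed
    then have "span {x. (\<forall>a\<in>K. a \<bullet> x = 0) \<and> (\<forall>i. x $ i \<in> \<rat>)} \<subseteq> {x. g \<bullet> x = 0}"
      by (intro span_minimal subspace_hyperplane) auto
    then have "g \<bullet> z0 = 0"
      using rational_subspace_spanned[OF K(1,2)] a(2) K(3) by blast
    then show False using a(3) N(1) by (simp add: g_def)
  qed
  then obtain z1 where z1: "z1 \<in> cell_lattice \<sigma>" "g \<bullet> z1 \<noteq> 0" by blast
  have lat_sub: "x - of_int m *\<^sub>R y \<in> cell_lattice \<sigma>"
    if "x \<in> cell_lattice \<sigma>" "y \<in> cell_lattice \<sigma>" for x y and m :: int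
    using that subH unfolding cell_lattice_def
    by (auto intro!: subspace_diff subspace_scale)
  have lat_int: "g \<bullet> z \<in> \<int>" if "z \<in> cell_lattice \<sigma>" for z
    using that g_int unfolding cell_lattice_def inner_vec_def by (auto intro!: Ints_sum Ints_mult)
  have "\<exists>n::nat. n > 0 \<and> (\<exists>z\<in>cell_lattice \<sigma>. g \<bullet> z = real n)"
  proof -
    obtain m where m: "g \<bullet> z1 = of_int m" using lat_int[OF z1(1)] Ints_cases by blast
    have "z1 - of_int 2 *\<^sub>R z1 \<in> cell_lattice \<sigma>" using lat_sub[OF z1(1) z1(1)] .
    moreover have "z1 - of_int 2 *\<^sub>R z1 = - z1" by (simp add: scaleR_2)
    ultimately have "- z1 \<in> cell_lattice \<sigma>" by (simp only:)
    then show ?thesis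
      using z1 m by (intro exI[of _ "nat \<bar>m\<bar>"] conjI bexI[of _ "if m > 0 then z1 else - z1"]) auto
  qed
  then obtain n where n: "n > 0" "\<exists>z\<in>cell_lattice \<sigma>. g \<bullet> z = real n"
    "\<And>k. k < n \<Longrightarrow> \<not> (k > 0 \<and> (\<exists>z\<in>cell_lattice \<sigma>. g \<bullet> z = real k))"
    using exists_least_iff[of "\<lambda>n. n > 0 \<and> (\<exists>z\<in>cell_lattice \<sigma>. g \<bullet> z = real n)"] by auto
  then obtain u where u: "u \<in> cell_lattice \<sigma>" "g \<bullet> u = real n" by blast
  have gen: "\<exists>c::int. z - of_int c *\<^sub>R u \<in> cell_lattice \<tau>" if z: "z \<in> cell_lattice \<sigma>" for z
  proof -
    obtain m where m: "g \<bullet> z = of_int m" using lat_int[OF z] Ints_cases by blast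
    \<comment> \<open>The remainder vector stays in the lattice and has the value
      \<open>m mod int n\<close> under \<open>g\<close>, which is below the least positive value and
      hence zero.\<close>
    define c where "c = m div int n"
    have zc: "z - of_int c *\<^sub>R u \<in> cell_lattice \<sigma>" using z u lat_sub by blast
    have "g \<bullet> (z - of_int c *\<^sub>R u) = of_int (m - c * int n)"
      by (simp add: inner_diff_right m u)
    also have "m - c * int n = m mod int n" by (simp add: c_def minus_div_mult_eq_mod)
    also have "of_int (m mod int n) = real (nat (m mod int n))" using n(1) by simp
    finally have val: "g \<bullet> (z - of_int c *\<^sub>R u) = real (nat (m mod int n))" .
    have "nat (m mod int n) < n" using n(1) by (simp add: nat_less_iff)
    from n(3)[OF this] have "nat (m mod int n) = 0" using zc val by (metis gr0I)
    then have "g \<bullet> (z - of_int c *\<^sub>R u) = 0" using val by simp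
    then have "z - of_int c *\<^sub>R u \<in> ?T" using zc T_eq by (auto simp: cell_lattice_def)
    then show ?thesis using zc by (auto simp: cell_lattice_def)
  qed
  have "\<exists>y\<in>\<sigma>. g \<bullet> (y - q) \<noteq> 0"
  proof (rule ccontr)
    assume "\<not> ?thesis"
    then have "\<sigma> \<subseteq> {x. g \<bullet> x = g \<bullet> q}" by (auto simp: inner_diff_right)
    then have hull: "affine hull \<sigma> \<subseteq> {x. g \<bullet> x = g \<bullet> q}"
      by (intro hull_minimal affine_hyperplane)
    obtain x y where "z0 = x - y" "x \<in> affine hull \<sigma>" "y \<in> affine hull \<sigma>"
      using a(2) by (auto simp: direction_space_def)
    moreover from this have "g \<bullet> x = g \<bullet> q" "g \<bullet> y = g \<bullet> q" using hull by blast+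
    ultimately have "g \<bullet> z0 = 0" by (simp add: inner_diff_right)
    then show False using a(3) N(1) by (simp add: g_def)
  qed
  then obtain y where y: "y \<in> \<sigma>" "g \<bullet> (y - q) \<noteq> 0" by blast
  moreover have "g \<bullet> (y - q) \<ge> 0"
    using J(4) a(1) y(1) N(1) by (simp add: g_def inner_diff_right)
  ultimately have pos: "g \<bullet> (y - q) > 0" by simp
  \<comment> \<open>This factor gives \<open>u\<close> and \<open>c *\<^sub>R (y - q)\<close> the
    same value under \<open>g\<close>, so their difference lies in the directions of \<tau>.\<close>
  define c where "c = (g \<bullet> u) / (g \<bullet> (y - q))"
  have cpos: "c > 0" using pos n(1) u(2) by (simp add: c_def)
  have "y - q \<in> ?H" using y(1) q\<tau> sub diff_in_direction_space by blast
  then have "u - c *\<^sub>R (y - q) \<in> ?H"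
    using u(1) subH by (auto simp: cell_lattice_def intro!: subspace_diff subspace_scale)
  moreover have "g \<bullet> (u - c *\<^sub>R (y - q)) = 0"
    using pos by (simp add: inner_diff_right[of g u] c_def)
  ultimately have "u - c *\<^sub>R (y - q) \<in> ?T" using T_eq by blast
  then have "represents_primitive_normal \<sigma> \<tau> u"
    unfolding represents_primitive_normal_def using u(1) gen q\<tau> y(1) cpos by blast
  moreover have "u \<notin> ?T" using gT u(2) n(1) by force
  ultimately show ?thesis by blast
qed

text \<open>The definition does not itself demand a vector outside
  \<open>direction_space \<tau>\<close>. The chosen vector is outside because the one constructed
  above is an integer multiple of it modulo that space.\<close>

lemma primitive_normal:
  fixes \<sigma> \<tau> :: "(real ^ 'n) set"
  assumes "rational_polyhedron \<sigma>" "\<tau> face_of \<sigma>" "\<tau> \<noteq> {}" "aff_dim \<tau> = aff_dim \<sigma> - 1"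
  shows "represents_primitive_normal \<sigma> \<tau> (primitive_normal \<sigma> \<tau>)"
    and "primitive_normal \<sigma> \<tau> \<notin> direction_space \<tau>"
proof -
  let ?u = "primitive_normal \<sigma> \<tau>"
  obtain u where u: "represents_primitive_normal \<sigma> \<tau> u" "u \<notin> direction_space \<tau>"
    using represents_primitive_normal_exists[OF assms] by blast
  show rep: "represents_primitive_normal \<sigma> \<tau> ?u"
    unfolding primitive_normal_def using u(1) by (rule someI)
  obtain c :: int where c: "u - of_int c *\<^sub>R ?u \<in> direction_space \<tau>"
    using rep u(1) unfolding represents_primitive_normal_def cell_lattice_def by blast
  show "?u \<notin> direction_space \<tau>"
  proof
    assume "?u \<in> direction_space \<tau>"
    then have "(u - of_int c *\<^sub>R ?u) + of_int c *\<^sub>R ?u \<in> direction_space \<tau>"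
      using c subspace_direction_space[OF assms(3)] by (intro subspace_add subspace_scale)
    then show False using u(2) by simp
  qed
qed

section \<open>General position\<close>

text \<open>Finitely many sets of deficient dimension have measure zero together, so they cannot
  cover a ball.\<close>

lemma avoid_subspaces:
  fixes x :: "'a::euclidean_space"
  assumes "finite \<V>" "\<And>V. V \<in> \<V> \<Longrightarrow> dim V < DIM('a)" "e > 0"
  obtains y where "dist y x < e" "\<And>V. V \<in> \<V> \<Longrightarrow> y \<notin> V"
proof -
  have "negligible (\<Union>\<V>)" using assms by (intro negligible_Union negligible_lowdim) auto
  moreover have "\<not> negligible (ball x e)" using assms(3) by (intro open_not_negligible) auto
  ultimately have "\<not> ball x e \<subseteq> \<Union>\<V>" using negligible_subset by blast
  then obtain y where "y \<in> ball x e" "y \<notin> \<Union>\<V>" by blast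
  then show ?thesis using that by (metis UnionI dist_commute mem_ball)
qed

lemma dim_sums_le:
  fixes S T :: "'a::euclidean_space set"
  assumes "subspace S" "subspace T"
  shows "dim {x + y |x y. x \<in> S \<and> y \<in> T} \<le> dim S + dim T"
  using dim_sums_Int[OF assms] by linarith

lemma complementary_subspaces_sum:
  fixes S T :: "'a::euclidean_space set"
  assumes "subspace S" "subspace T" "S \<inter> T \<subseteq> {0}" "dim S + dim T = DIM('a)"
  obtains y z where "y \<in> S" "z \<in> T" "x = y + z"
proof -
  have "dim (S \<inter> T) = 0" using assms(3) dim_subset[of "S \<inter> T" "{0}"] by simp
  then have "dim {x + y |x y. x \<in> S \<and> y \<in> T} = DIM('a)"
    using dim_sums_Int[OF assms(1,2)] assms(4) by linarith
  then have "span {x + y |x y. x \<in> S \<and> y \<in> T} = UNIV"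
    by (simp only: dim_eq_full)
  then have "{x + y |x y. x \<in> S \<and> y \<in> T} = UNIV"
    using span_eq_iff[THEN iffD2, OF subspace_sums[OF assms(1,2)]] by (simp only:)
  then show ?thesis using that by blast
qed

text \<open>The conclusion makes the perturbed vectors linearly independent modulo each
  \<open>H\<close>. They are chosen one at a time: the next one avoids, for every \<open>H\<close>,
  the sum of \<open>H\<close> and the span of the earlier choices, which the dimension bound keeps
  proper.\<close>

lemma transversal_perturbation:
  fixes B :: "'a::euclidean_space set"
  assumes "finite B" "finite \<H>" "\<And>H. H \<in> \<H> \<Longrightarrow> subspace H \<and> dim H + card B \<le> DIM('a)" "e > 0"
  shows "\<exists>f. (\<forall>b\<in>B. dist (f b) b < e) \<and>
    (\<forall>H\<in>\<H>. \<forall>u. (\<Sum>b\<in>B. u b *\<^sub>R f b) \<in> H \<longrightarrow> (\<forall>b\<in>B. u b = 0))"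
  using assms(1,3)
proof (induction B)
  case empty
  then show ?case by auto
next
  case (insert b B)
  have "subspace H \<and> dim H + card B \<le> DIM('a)" if "H \<in> \<H>" for H
    using insert.prems[OF that] insert.hyps by simp
  then obtain f where f: "\<forall>b\<in>B. dist (f b) b < e"
    "\<forall>H\<in>\<H>. \<forall>u. (\<Sum>b\<in>B. u b *\<^sub>R f b) \<in> H \<longrightarrow> (\<forall>b\<in>B. u b = 0)"
    using insert.IH by blast
  define V where "V = (\<lambda>H. {x + y |x y. x \<in> H \<and> y \<in> span (f ` B)})"
  have "dim (V H) < DIM('a)" if H: "H \<in> \<H>" for H
  proof -
    have "dim (span (f ` B)) \<le> card B"
      using insert.hyps(1) card_image_le[of B f] dim_le_card[of "span (f ` B)" "f ` B"] by simp
    then have "dim (V H) \<le> dim H + card B"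
      using dim_sums_le[of H "span (f ` B)"] insert.prems H unfolding V_def by fastforce
    also have "\<dots> < DIM('a)" using insert.prems[OF H] insert.hyps by simp
    finally show ?thesis .
  qed
  then have dimV: "dim W < DIM('a)" if "W \<in> V ` \<H>" for W using that by blast
  obtain b' where "dist b' b < e" "\<And>W. W \<in> V ` \<H> \<Longrightarrow> b' \<notin> W"
    using avoid_subspaces[OF finite_imageI[OF assms(2)] dimV assms(4)] by blast
  then have b': "dist b' b < e" "\<And>H. H \<in> \<H> \<Longrightarrow> b' \<notin> V H" by blast+
  define f' where "f' = f(b := b')"
  have f'B: "f' x = f x" if "x \<in> B" for x using that insert.hyps by (auto simp: f'_def)
  have "\<forall>x\<in>insert b B. u x = 0" if H: "H \<in> \<H>" and u: "(\<Sum>b\<in>insert b B. u b *\<^sub>R f' b) \<in> H" for H u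
  proof -
    have sH: "subspace H" using insert.prems H by blast
    have eq: "(\<Sum>b\<in>insert b B. u b *\<^sub>R f' b) = u b *\<^sub>R b' + (\<Sum>b\<in>B. u b *\<^sub>R f b)"
      using insert.hyps f'B by (simp add: f'_def cong: sum.cong)
    \<comment> \<open>Dividing by a nonzero coefficient would write \<open>b'\<close> as an element
      of \<open>H\<close> plus a combination of the earlier vectors, which its choice
      excludes.\<close>
    have ub: "u b = 0"
    proof (rule ccontr)
      assume nz: "u b \<noteq> 0"
      let ?h = "\<Sum>b\<in>insert b B. u b *\<^sub>R f' b" and ?s = "\<Sum>b\<in>B. u b *\<^sub>R f b"
      have "u b *\<^sub>R b' = ?h - ?s" using eq by simp
      then have "(1 / u b) *\<^sub>R (u b *\<^sub>R b') = (1 / u b) *\<^sub>R (?h - ?s)" by simp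
      then have "b' = (1 / u b) *\<^sub>R ?h + (- (1 / u b)) *\<^sub>R ?s"
        using nz by (simp add: scaleR_diff_right)
      moreover have "(1 / u b) *\<^sub>R ?h \<in> H" using sH u subspace_scale by blast
      moreover have "(- (1 / u b)) *\<^sub>R ?s \<in> span (f ` B)"
        by (intro span_scale span_sum span_base) auto
      ultimately have "b' \<in> V H" unfolding V_def by blast
      then show False using b'(2) H by blast
    qed
    then have "(\<Sum>b\<in>B. u b *\<^sub>R f b) \<in> H" using u eq by simp
    then show ?thesis using f(2) H ub by auto
  qed
  moreover have "\<forall>x\<in>insert b B. dist (f' x) x < e" using f(1) b'(1) by (auto simp: f'_def)
  ultimately show ?case by blast
qed

section \<open>Tropical varieties near a point\<close>

lemma rational_polyhedron_imp_polyhedron: "rational_polyhedron S \<Longrightarrow> polyhedron S"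
proof -
  assume "rational_polyhedron S"
  then obtain F where F: "finite F" "S = \<Inter>F"
    "\<forall>h\<in>F. \<exists>a b. a \<noteq> 0 \<and> (\<forall>i. a $ i \<in> \<rat>) \<and> h = {x. a \<bullet> x \<le> b}"
    unfolding rational_polyhedron_def by blast
  moreover have "\<forall>h\<in>F. \<exists>a b. a \<noteq> 0 \<and> h = {x. a \<bullet> x \<le> b}" using F(3) by blast
  ultimately show ?thesis unfolding polyhedron_def by blast
qed

text \<open>A minimal cell containing \<open>q\<close> works: a facet through \<open>q\<close> would
  be a smaller cell, and removing all facets from a polyhedron leaves its relative interior.\<close>

lemma carrier_cell:
  assumes "finite C" "rational_polyhedral_complex C" "q \<in> \<Union>C"
  obtains \<tau> where "\<tau> \<in> C" "q \<in> rel_interior \<tau>"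
proof -
  obtain \<tau> where \<tau>: "\<tau> \<in> C" "q \<in> \<tau>" "\<And>\<rho>. \<rho> \<in> C \<Longrightarrow> q \<in> \<rho> \<Longrightarrow> \<rho> \<subseteq> \<tau> \<Longrightarrow> \<rho> = \<tau>"
    using finite_has_minimal[of "{\<tau>\<in>C. q \<in> \<tau>}"] assms(1,3) by auto
  have poly: "polyhedron \<tau>"
    using assms(2) \<tau>(1) rational_polyhedron_imp_polyhedron
    unfolding rational_polyhedral_complex_def by blast
  have "q \<notin> F" if F: "F facet_of \<tau>" for F
  proof
    assume q: "q \<in> F"
    then have "F \<in> C"
      using F \<tau>(1) assms(2) unfolding rational_polyhedral_complex_def facet_of_def by blast
    then have "F = \<tau>" using \<tau>(3) q F facet_of_imp_subset by blast
    then show False using F by (simp add: facet_of_def)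
  qed
  then have "q \<in> rel_interior \<tau>" using rel_interior_of_polyhedron[OF poly] \<tau>(2) by blast
  then show ?thesis using that \<tau>(1) by blast
qed

text \<open>Purity gives the dimension of a maximal cell above \<tau>. The face relation comes from
  the intersection axiom of complexes.\<close>

lemma top_dimensional_cell:
  assumes "finite C" "pure_complex p C" "\<tau> \<in> C"
  obtains \<sigma> where "\<sigma> \<in> C" "aff_dim \<sigma> = int p" "\<tau> face_of \<sigma>" "\<tau> \<subseteq> \<sigma>"
proof -
  obtain \<sigma> where \<sigma>: "\<sigma> \<in> C" "\<tau> \<subseteq> \<sigma>" "\<forall>\<rho>\<in>C. \<sigma> \<subseteq> \<rho> \<longrightarrow> \<sigma> = \<rho>"
    using finite_has_maximal2[OF assms(1,3)] by auto
  have complex: "rational_polyhedral_complex C" using assms(2) by (simp add: pure_complex_def)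
  have "aff_dim \<sigma> = int p" using assms(2) \<sigma>(1,3) unfolding pure_complex_def by auto
  moreover have "\<sigma> \<inter> \<tau> face_of \<sigma>"
    using assms(3) \<sigma>(1) complex unfolding rational_polyhedral_complex_def by blast
  moreover have "\<sigma> \<inter> \<tau> = \<tau>" using \<sigma>(2) by blast
  ultimately show ?thesis using that \<sigma>(1,2) by simp
qed

text \<open>If \<open>v\<close> is not already in the sum of \<open>M\<close> and the directions of \<open>\<tau>\<close>, this sum is a hyperplane.
  By balancing with positive weights the primitive normals at \<open>\<tau>\<close> lie on both of its sides,
  so one of them points to the side of \<open>v\<close>.\<close>

lemma tropical_variety_step:
  fixes C :: "(real ^ 'n) set set" and v :: "real ^ 'n"
  assumes trop: "tropical_variety k C w"
    and \<tau>: "\<tau> \<in> C" "q \<in> rel_interior \<tau>" "aff_dim \<tau> \<ge> int k - 1"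
    and M: "subspace M" "dim M + k = CARD('n)"
    and trans: "\<And>\<sigma>. \<sigma> \<in> C \<Longrightarrow> aff_dim \<sigma> = int k \<Longrightarrow> direction_space \<sigma> \<inter> M \<subseteq> {0}"
  shows "\<exists>y\<in>M. \<forall>\<^sub>F t in at_right 0. q + t *\<^sub>R (v + y) \<in> \<Union>C"
proof -
  have fin: "finite C" and pure: "pure_complex k C" and bal: "balanced k C w"
    and wpos: "\<And>\<sigma>. \<sigma> \<in> C \<Longrightarrow> aff_dim \<sigma> = int k \<Longrightarrow> w \<sigma> > 0"
    using trop by (auto simp: tropical_variety_def)
  have cell: "rational_polyhedron \<sigma>" "\<sigma> \<noteq> {}" if "\<sigma> \<in> C" for \<sigma>
    using that pure by (auto simp: pure_complex_def rational_polyhedral_complex_def)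
  then have conv: "convex \<sigma>" if "\<sigma> \<in> C" for \<sigma>
    using that polyhedron_imp_convex rational_polyhedron_imp_polyhedron by auto
  let ?T = "direction_space \<tau>"
  have q\<tau>: "q \<in> \<tau>" using \<tau>(2) rel_interior_subset by blast
  have subT: "subspace ?T" using subspace_direction_space cell \<tau>(1) by blast
  have dimT: "int (dim ?T) = aff_dim \<tau>" using dim_direction_space cell \<tau>(1) by blast
  obtain \<sigma>0 where \<sigma>0: "\<sigma>0 \<in> C" "aff_dim \<sigma>0 = int k" "\<tau> face_of \<sigma>0" "\<tau> \<subseteq> \<sigma>0"
    using top_dimensional_cell[OF fin pure \<tau>(1)] .
  have inter: "?T \<inter> M \<subseteq> {0}"
    using trans[OF \<sigma>0(1,2)] direction_space_mono[OF \<sigma>0(4)] by blast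
  define N where "N = {x + y |x y. x \<in> ?T \<and> y \<in> M}"
  have TN: "?T \<subseteq> N" "M \<subseteq> N"
    unfolding N_def using subspace_0[OF M(1)] subspace_0[OF subT] by force+
  show ?thesis
  proof (cases "v \<in> N")
    \<comment> \<open>Cancelling the \<open>M\<close>-part of \<open>v\<close> leaves a direction of
      \<tau> itself.\<close>
    case True
    then obtain h y where hy: "h \<in> ?T" "y \<in> M" "v = h + y" by (auto simp: N_def)
    have "\<forall>\<^sub>F t in at_right 0. q + t *\<^sub>R (v + - y) \<in> \<Union>C"
      using eventually_in_of_rel_interior[OF \<tau>(2) hy(1)]
      by eventually_elim (use hy(3) \<tau>(1) in auto)
    then show ?thesis using subspace_neg[OF M(1) hy(2)] by blast
  next
    case False
    \<comment> \<open>In dimension \<open>k\<close> the directions of \<tau> would complement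
      \<open>M\<close>, so \<open>N\<close> would be the whole space and contain \<open>v\<close>.
      Only codimension one remains.\<close>
    have "dim ?T \<noteq> k"
    proof
      assume "dim ?T = k"
      then obtain y z where "y \<in> ?T" "z \<in> M" "v = y + z"
        using complementary_subspaces_sum[OF subT M(1) inter, of v] M(2) by auto
      then show False using False by (auto simp: N_def)
    qed
    moreover have "aff_dim \<tau> \<le> int k" using aff_dim_subset[OF \<sigma>0(4)] \<sigma>0(2) by simp
    ultimately have aff\<tau>: "aff_dim \<tau> = int k - 1" and dimT': "dim ?T + 1 = k"
      using dimT \<tau>(3) by linarith+
    have "dim (?T \<inter> M) = 0" using inter by simp
    then have dimN: "dim N = CARD('n) - 1"
      using dim_sums_Int[OF subT M(1)] M(2) dimT' unfolding N_def by linarith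
    have subN: "subspace N" unfolding N_def by (rule subspace_sums[OF subT M(1)])
    have "dim N < DIM(real ^ 'n)" using dimN by simp
    then obtain a where a: "a \<noteq> 0" "\<And>y. y \<in> span N \<Longrightarrow> orthogonal a y"
      using orthogonal_to_subspace_exists by blast
    have N_eq: "N = {x. a \<bullet> x = 0}"
    proof (rule subspace_dim_equal[OF subN subspace_hyperplane])
      show "N \<subseteq> {x. a \<bullet> x = 0}" using a(2) span_base by (auto simp: orthogonal_def)
      show "dim N \<ge> dim {x. a \<bullet> x = 0}" using dimN dim_hyperplane[OF a(1)] by simp
    qed
    \<comment> \<open>The factor makes \<open>g\<close> positive at \<open>v\<close>, whichever sign
      \<open>a\<close> was given.\<close>
    define g where "g = (a \<bullet> v) *\<^sub>R a"
    have av: "a \<bullet> v \<noteq> 0" using False N_eq by blast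
    then have gN: "g \<bullet> x = 0 \<longleftrightarrow> x \<in> N" for x using N_eq by (simp add: g_def)
    have gv: "g \<bullet> v > 0" 
      unfolding g_def inner_scaleR_left using av not_real_square_gt_zero[of "a \<bullet> v"] by blast
    let ?u = "\<lambda>\<sigma>. primitive_normal \<sigma> \<tau>"
    define St where "St = {\<sigma>. \<sigma> \<in> C \<and> aff_dim \<sigma> = int k \<and> \<tau> face_of \<sigma>}"
    have finSt: "finite St" using fin by (simp add: St_def)
    have norm: "represents_primitive_normal \<sigma> \<tau> (?u \<sigma>)" "?u \<sigma> \<notin> ?T" if "\<sigma> \<in> St" for \<sigma>
      using primitive_normal[of \<sigma> \<tau>] that cell \<tau>(1) aff\<tau> by (auto simp: St_def)
    \<comment> \<open>A normal in \<open>N\<close> would, after subtracting its part along \<tau>,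
      give a vector of \<open>M\<close> among the directions of \<sigma>. Transversality makes that
      vector zero, so the normal would be a direction of \<tau>.\<close>
    have nz: "g \<bullet> ?u \<sigma> \<noteq> 0" if \<sigma>: "\<sigma> \<in> St" for \<sigma>
    proof
      assume "g \<bullet> ?u \<sigma> = 0"
      then obtain h y where hy: "h \<in> ?T" "y \<in> M" "?u \<sigma> = h + y" using gN by (auto simp: N_def)
      have H: "?u \<sigma> \<in> direction_space \<sigma>"
        using norm(1)[OF \<sigma>] by (simp add: represents_primitive_normal_def cell_lattice_def)
      have "h \<in> direction_space \<sigma>"
        using hy(1) direction_space_mono \<sigma> face_of_imp_subset by (auto simp: St_def)
      then have "?u \<sigma> - h \<in> direction_space \<sigma>"
        using H \<sigma> cell by (intro subspace_diff subspace_direction_space) (auto simp: St_def)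
      then have "y \<in> direction_space \<sigma> \<inter> M" using hy by simp
      then have "y = 0" using trans \<sigma> by (auto simp: St_def)
      then show False using norm(2)[OF \<sigma>] hy by simp
    qed
    \<comment> \<open>Balancing makes the weighted sum of the values of \<open>g\<close> zero. With
      positive weights they cannot all be negative, since \<open>\<sigma>0\<close> makes the sum
      nonempty.\<close>
    have "\<exists>\<sigma>\<in>St. g \<bullet> ?u \<sigma> > 0"
    proof (rule ccontr)
      assume "\<not> ?thesis"
      then have neg: "g \<bullet> ?u \<sigma> < 0" if "\<sigma> \<in> St" for \<sigma> using nz that by force
      have "(\<Sum>\<sigma>\<in>St. w \<sigma> *\<^sub>R ?u \<sigma>) \<in> span (cell_lattice \<tau>)"
        using bal \<tau>(1) aff\<tau> unfolding balanced_def St_def by blast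
      moreover have "span (cell_lattice \<tau>) \<subseteq> ?T"
        by (intro span_minimal subT) (auto simp: cell_lattice_def)
      ultimately have "g \<bullet> (\<Sum>\<sigma>\<in>St. w \<sigma> *\<^sub>R ?u \<sigma>) = 0" using gN TN by blast
      then have "(\<Sum>\<sigma>\<in>St. w \<sigma> * - (g \<bullet> ?u \<sigma>)) = 0"
        by (simp add: inner_sum_right sum_negf)
      moreover have "(\<Sum>\<sigma>\<in>St. w \<sigma> * - (g \<bullet> ?u \<sigma>)) > 0"
        using finSt neg wpos \<sigma>0 by (intro sum_pos mult_pos_pos) (auto simp: St_def)
      ultimately show False by simp
    qed
    then obtain \<sigma> where \<sigma>: "\<sigma> \<in> St" "g \<bullet> ?u \<sigma> > 0" by blast
    then have \<sigma>C: "\<sigma> \<in> C" and \<tau>\<sigma>: "\<tau> \<subseteq> \<sigma>" using face_of_imp_subset by (auto simp: St_def)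
    obtain x y c where xyc: "x \<in> \<tau>" "y \<in> \<sigma>" "c > 0" "?u \<sigma> - c *\<^sub>R (y - x) \<in> ?T"
      using norm(1)[OF \<sigma>(1)] unfolding represents_primitive_normal_def by blast
    \<comment> \<open>This multiple of the normal has the same value under \<open>g\<close> as
      \<open>v\<close>, so the two differ by an element of \<open>N\<close>.\<close>
    define \<alpha> where "\<alpha> = (g \<bullet> v) / (g \<bullet> ?u \<sigma>)"
    have "g \<bullet> (v - \<alpha> *\<^sub>R ?u \<sigma>) = 0" using \<sigma>(2) by (simp add: inner_diff_right \<alpha>_def)
    then obtain h z where hz: "h \<in> ?T" "z \<in> M" "v - \<alpha> *\<^sub>R ?u \<sigma> = h + z"
      using gN by (auto simp: N_def)
    define \<beta> where "\<beta> = \<alpha> * c"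
    have \<beta>: "\<beta> > 0" using gv \<sigma>(2) xyc(3) by (simp add: \<beta>_def \<alpha>_def)
    \<comment> \<open>\<open>h2\<close> gathers all that runs along \<tau>: \<open>h\<close>, the
      discrepancy between the normal and the arrow from \<open>x\<close> to \<open>y\<close>, and
      the shift of the foot of that arrow from \<open>x\<close> to \<open>q\<close>.\<close>
    define h2 where "h2 = h + \<alpha> *\<^sub>R (?u \<sigma> - c *\<^sub>R (y - x)) + \<beta> *\<^sub>R (q - x)"
    have "q - x \<in> ?T" using q\<tau> xyc(1) by (rule diff_in_direction_space)
    then have h2: "h2 \<in> ?T"
      unfolding h2_def by (intro subspace_add[OF subT] subspace_scale[OF subT] hz(1) xyc(4))
    have vz: "v + - z = \<beta> *\<^sub>R (y - q) + h2"
      using hz(3) by (simp add: h2_def \<beta>_def algebra_simps)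
    \<comment> \<open>The moving point will be the midpoint of a point of the segment from
      \<open>q\<close> to \<open>y\<close> and a point of \<tau>; halving them accounts for the
      doubled coefficients.\<close>
    have "2 *\<^sub>R h2 \<in> ?T" using h2 subT subspace_scale by blast
    note ev1 = eventually_in_of_rel_interior[OF \<tau>(2) this]
    have ev2: "\<forall>\<^sub>F t in at_right (0::real). norm (t *\<^sub>R (1::real)) < 1 / (2 * \<beta>)"
      using \<beta> by (intro eventually_scaled_in_ball) simp
    have "\<forall>\<^sub>F t in at_right 0. q + t *\<^sub>R (v + - z) \<in> \<Union>C"
      using ev1 ev2 eventually_at_right_less[of "0::real"]
    proof eventually_elim
      case (elim t)
      have t: "0 \<le> 2 * t * \<beta>" "2 * t * \<beta> \<le> 1" using elim \<beta> by (auto simp: field_simps)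
      have 1: "(1 - 2 * t * \<beta>) *\<^sub>R q + (2 * t * \<beta>) *\<^sub>R y \<in> \<sigma>"
        using t conv[OF \<sigma>C] q\<tau> \<tau>\<sigma> xyc(2) by (intro convexD_alt) auto
      have 2: "q + t *\<^sub>R (2 *\<^sub>R h2) \<in> \<sigma>" using elim(1) \<tau>\<sigma> by blast
      have "(1 - 1/2) *\<^sub>R ((1 - 2 * t * \<beta>) *\<^sub>R q + (2 * t * \<beta>) *\<^sub>R y) +
          (1/2) *\<^sub>R (q + t *\<^sub>R (2 *\<^sub>R h2)) \<in> \<sigma>"
        by (rule convexD_alt[OF conv[OF \<sigma>C] 1 2]) auto
      also have "(1 - 1/2) *\<^sub>R ((1 - 2 * t * \<beta>) *\<^sub>R q + (2 * t * \<beta>) *\<^sub>R y) +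
          (1/2) *\<^sub>R (q + t *\<^sub>R (2 *\<^sub>R h2)) = q + t *\<^sub>R (v + - z)"
        unfolding vz by (simp add: vec_eq_iff field_simps)
      finally show ?case using \<sigma>C by blast
    qed
    moreover have "- z \<in> M" using hz(2) M(1) subspace_neg by blast
    ultimately show ?thesis by blast
  qed
qed

section \<open>Local convexity of the complement: the moving disk\<close>

theorem theorem1:
  fixes C :: "(real ^ 'n) set set"
    and w :: "(real ^ 'n) set \<Rightarrow> real"
    and k :: nat
  assumes "tropical_variety k C w"
  shows "locally_m_convex (CARD('n) - k) (- \<Union>C)"
  unfolding locally_m_convex_def
proof
  assume "\<exists>B. supporting_cap (CARD('n) - k) (- (- \<Union>C)) B"
  then obtain B where "supporting_cap (CARD('n) - k) (\<Union>C) B" by auto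
  then obtain L c \<delta> v where L: "affine L" "aff_dim L = int (CARD('n) - k)" "c \<in> L" "\<delta> > 0"
    and B: "B = ball c \<delta> \<inter> L" and ne: "B \<inter> \<Union>C \<noteq> {}" and K: "compact (B \<inter> \<Union>C)"
    and v: "\<forall>\<^sub>F \<epsilon> in at_right 0. (\<lambda>x. x + \<epsilon> *\<^sub>R v) ` B \<inter> \<Union>C = {}"
    unfolding supporting_cap_def by (elim conjE exE) (rule that; assumption)
  from ne obtain p0 where p0: "p0 \<in> B" "p0 \<in> \<Union>C" by auto
  have fin: "finite C" and pure: "pure_complex k C"
    using assms by (auto simp: tropical_variety_def)
  have complex: "rational_polyhedral_complex C" using pure by (simp add: pure_complex_def)
  have cell: "polyhedron \<sigma>" "\<sigma> \<noteq> {}" if "\<sigma> \<in> C" for \<sigma>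
    using that complex rational_polyhedron_imp_polyhedron
    by (auto simp: rational_polyhedral_complex_def)
  have closedA: "closed (\<Union>C)" using fin cell polyhedron_imp_closed by (intro closed_Union) auto
  obtain \<sigma>0 where \<sigma>0: "\<sigma>0 \<in> C" "aff_dim \<sigma>0 = int k" "p0 \<in> \<sigma>0"
    using p0(2) top_dimensional_cell[OF fin pure] by (metis UnionE subsetD)
  \<comment> \<open>This rules out truncation in \<open>CARD('n) - k\<close>, so the plane really
    has complementary dimension.\<close>
  have kn: "k \<le> CARD('n)" using aff_dim_le_DIM[of \<sigma>0] \<sigma>0(2) by simp

  define M0 where "M0 = (\<lambda>x. - c + x) ` L"
  have subM0: "subspace M0" unfolding M0_def by (rule affine_diffs_subspace[OF L(1,3)])
  have dimM0: "dim M0 + k = CARD('n)"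
    using aff_dim_eq_dim[of c L] L kn unfolding M0_def by (simp add: hull_same hull_inc)
  have M0L: "c + d \<in> L" if "d \<in> M0" for d using that by (auto simp: M0_def)

  \<comment> \<open>Distance of the rim and of the final translate from the variety\<close>
  have "continuous_on (B \<inter> \<Union>C) (dist c)"
    by (intro continuous_on_dist continuous_on_const continuous_on_id)
  then obtain x1 where x1: "x1 \<in> B \<inter> \<Union>C" "\<And>x. x \<in> B \<inter> \<Union>C \<Longrightarrow> dist c x \<le> dist c x1"
    using continuous_attains_sup[OF K ne, of "dist c"] by blast
  \<comment> \<open>\<open>x1\<close> is a contact point farthest from the center; \<open>r\<close>
    lies halfway between its distance and the radius of the open disk.\<close>
  define r where "r = (dist c x1 + \<delta>) / 2"
  have x1\<delta>: "dist c x1 < \<delta>" using x1(1) B by simp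
  have "dist c x < r" if "x \<in> B \<inter> \<Union>C" for x
    using x1(2)[OF that] x1\<delta> unfolding r_def by (simp add: field_simps)
  moreover have "0 < r" "r < \<delta>"
    using x1\<delta> add_nonneg_pos[OF zero_le_dist L(4), of c x1] by (auto simp: r_def field_simps)
  ultimately have r: "0 < r" "r < \<delta>" "\<And>x. x \<in> B \<inter> \<Union>C \<Longrightarrow> dist c x < r" by blast+
  have inB: "c + d \<in> B" if "d \<in> M0" "norm d \<le> r" for d
    using that M0L r(2) by (simp add: B dist_norm)
  have cpt: "compact (M0 \<inter> sphere 0 r)" "compact (M0 \<inter> cball 0 r)"
    using closed_subspace[OF subM0] by (auto intro: closed_Int_compact)

  have 1: "compact ((+) c ` (M0 \<inter> sphere 0 r))"
    by (intro compact_continuous_image cpt continuous_intros)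
  have 2: "(+) c ` (M0 \<inter> sphere 0 r) \<inter> \<Union>C = {}" using inB r(3) by (force simp: dist_norm)
  obtain \<eta>1 where \<eta>1_pos: "\<eta>1 > 0"
    and sep: "\<forall>x\<in>(+) c ` (M0 \<inter> sphere 0 r). \<forall>a\<in>\<Union>C. \<eta>1 \<le> dist x a"
    using separate_compact_closed[OF 1 closedA 2] by blast
  have \<eta>1: "\<eta>1 \<le> dist (c + d) a" if "d \<in> M0" "norm d = r" "a \<in> \<Union>C" for d a
    by (intro sep[rule_format] image_eqI[of _ _ d]) (use that in auto)
  have "\<forall>\<^sub>F \<epsilon> in at_right (0::real). norm (\<epsilon> *\<^sub>R v) < \<eta>1 / 2"
    using \<eta>1_pos by (intro eventually_scaled_in_ball) simp
  then obtain \<epsilon> :: real where \<epsilon>: "norm (\<epsilon> *\<^sub>R v) < \<eta>1 / 2" "(\<lambda>x. x + \<epsilon> *\<^sub>R v) ` B \<inter> \<Union>C = {}"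
    using eventually_happens'[OF trivial_limit_at_right_real eventually_conj[OF _ v]] by blast
  define v0 where "v0 = \<epsilon> *\<^sub>R v"
  have 1: "compact ((\<lambda>d. c + d + v0) ` (M0 \<inter> cball 0 r))"
    by (intro compact_continuous_image cpt continuous_intros)
  have 2: "(\<lambda>d. c + d + v0) ` (M0 \<inter> cball 0 r) \<inter> \<Union>C = {}"
    using inB \<epsilon>(2) by (fastforce simp: v0_def)
  obtain \<eta>2 where \<eta>2_pos: "\<eta>2 > 0"
    and sep: "\<forall>x\<in>(\<lambda>d. c + d + v0) ` (M0 \<inter> cball 0 r). \<forall>a\<in>\<Union>C. \<eta>2 \<le> dist x a"
    using separate_compact_closed[OF 1 closedA 2] by blast
  have \<eta>2: "\<eta>2 \<le> dist (c + d + v0) a" if "d \<in> M0" "norm d \<le> r" "a \<in> \<Union>C" for d a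
    by (intro sep[rule_format] image_eqI[of _ _ d]) (use that in auto)
  \<comment> \<open>The rim itself travels by less than \<open>\<eta>1 / 2\<close>, which leaves the
    other half for the perturbation.\<close>
  define \<eta> where "\<eta> = min (\<eta>1 / 2) \<eta>2"
  have \<eta>: "\<eta> > 0" using \<eta>1_pos \<eta>2_pos by (simp add: \<eta>_def)

  \<comment> \<open>Perturbing the plane of the disk\<close>
  obtain E where E: "pairwise orthogonal E" "\<And>b. b \<in> E \<Longrightarrow> norm b = 1" "independent E"
    "card E = dim M0" "span E = M0"
    using orthonormal_basis_subspace[OF subM0] by metis
  have finE: "finite E" using E(3) independent_imp_finite by blast
  have expand: "(\<Sum>b\<in>E. (x \<bullet> b) *\<^sub>R b) = x" if "x \<in> M0" for x
    using orthonormal_basis_expand[OF E(1,2) _ finE] that E(5) by blast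
  define Top where "Top = {\<sigma>\<in>C. aff_dim \<sigma> = int k}"
  \<comment> \<open>\<open>m\<close> bounds the sum of the absolute coordinates of a vector of norm
    at most \<open>2 * r\<close>, so the perturbation chosen below moves such a vector by less than
    \<open>\<eta> / 3\<close>. The radius is doubled because \<open>T\<close> will act on
    differences of two points of the disk; adding 1 to \<open>m\<close> keeps the denominator
    positive.\<close>
  define m where "m = real (card E) * (2 * r)"
  have m0: "m \<ge> 0" using r(1) by (simp add: m_def)
  have e1: "\<eta> / (3 * (m + 1)) > 0" using m0 \<eta> by simp
  have finTop: "finite (direction_space ` Top)" using fin by (simp add: Top_def)
  have "subspace H \<and> dim H + card E \<le> DIM(real ^ 'n)" if H: "H \<in> direction_space ` Top" for H
  proof -
    obtain \<sigma> where \<sigma>: "\<sigma> \<in> C" "aff_dim \<sigma> = int k" "H = direction_space \<sigma>"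
      using H by (auto simp: Top_def)
    have "int (dim H) = int k" using dim_direction_space[OF cell(2)[OF \<sigma>(1)]] \<sigma>(2,3) by simp
    then show ?thesis
      using subspace_direction_space[OF cell(2)[OF \<sigma>(1)]] \<sigma>(3) E(4) dimM0 by simp
  qed
  then obtain f where f: "\<forall>b\<in>E. dist (f b) b < \<eta> / (3 * (m + 1))"
    "\<forall>H\<in>direction_space ` Top. \<forall>u. (\<Sum>b\<in>E. u b *\<^sub>R f b) \<in> H \<longrightarrow> (\<forall>b\<in>E. u b = 0)"
    using transversal_perturbation[OF finE finTop _ e1] by blast
  define T where "T = (\<lambda>x. \<Sum>b\<in>E. (x \<bullet> b) *\<^sub>R f b)"
  have linT: "linear T"
    unfolding T_def
    by (rule linearI) (auto simp: inner_add_left scaleR_add_left sum.distrib scaleR_sum_right)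
  have T_close: "norm (T x - x) < \<eta> / 3" if x: "x \<in> M0" "norm x \<le> 2 * r" for x
  proof -
    have "T x - x = (\<Sum>b\<in>E. (x \<bullet> b) *\<^sub>R (f b - b))"
      using expand[OF x(1)] by (simp add: T_def scaleR_diff_right sum_subtractf)
    also have "norm \<dots> \<le> (\<Sum>b\<in>E. 2 * r * (\<eta> / (3 * (m + 1))))"
    proof (rule sum_norm_le)
      fix b assume b: "b \<in> E"
      have "\<bar>x \<bullet> b\<bar> \<le> 2 * r" using Cauchy_Schwarz_ineq2[of x b] E(2)[OF b] x(2) by simp
      moreover have "norm (f b - b) \<le> \<eta> / (3 * (m + 1))" using f(1) b by (simp add: dist_norm less_imp_le)
      ultimately show "norm ((x \<bullet> b) *\<^sub>R (f b - b)) \<le> 2 * r * (\<eta> / (3 * (m + 1)))"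
        unfolding norm_scaleR by (intro mult_mono) (use r(1) in auto)
    qed
    also have "\<dots> = m * (\<eta> / (3 * (m + 1)))" by (simp add: m_def)
    also have "\<dots> < \<eta> / 3" using m0 \<eta> by (simp add: field_simps)
    finally show ?thesis .
  qed
  have T_trans: "\<forall>b\<in>E. x \<bullet> b = 0" if "\<sigma> \<in> C" "aff_dim \<sigma> = int k" "T x \<in> direction_space \<sigma>" for \<sigma> x
    using f(2) that unfolding T_def Top_def by blast
  define M1 where "M1 = T ` M0"
  have subM1: "subspace M1" unfolding M1_def by (rule linear_subspace_image[OF linT subM0])
  \<comment> \<open>Zero is a direction of \<open>\<sigma>0\<close>, so transversality to this cell
    makes \<open>T\<close> injective on \<open>M0\<close> and the dimension is preserved.\<close>
  have "x = 0" if "x \<in> M0" "T x = 0" for x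
  proof -
    have "T x \<in> direction_space \<sigma>0"
      using that(2) subspace_0[OF subspace_direction_space[OF cell(2)[OF \<sigma>0(1)]]] by simp
    then show ?thesis using T_trans[OF \<sigma>0(1,2)] expand[OF that(1)] by simp
  qed
  then have "inj_on T M0" using linear_inj_on_iff_eq_0[OF linT subM0] by blast
  then have dimM1: "dim M1 + k = CARD('n)"
    using dim_image_eq[OF linT, of M0] dimM0 subM0 span_eq_iff unfolding M1_def by metis
  have trans: "direction_space \<sigma> \<inter> M1 \<subseteq> {0}" if "\<sigma> \<in> C" "aff_dim \<sigma> = int k" for \<sigma>
    using T_trans[OF that] by (auto simp: M1_def T_def)
  have step: "\<exists>y\<in>M1. \<forall>\<^sub>F t in at_right 0. q + t *\<^sub>R (u + y) \<in> \<Union>C"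
    if "\<tau> \<in> C" "q \<in> rel_interior \<tau>" "aff_dim \<tau> \<ge> int k - 1" for \<tau> q u
    by (rule tropical_variety_step[OF assms that subM1 dimM1 trans])

  \<comment> \<open>Generic starting point and velocity\<close>
  have conv0: "convex \<sigma>0" using cell \<sigma>0(1) polyhedron_imp_convex by blast
  have "p0 \<in> closure (rel_interior \<sigma>0)"
    using convex_closure_rel_interior[OF conv0] \<sigma>0(3) closure_subset by blast
  then obtain p1 where p1: "p1 \<in> rel_interior \<sigma>0" "dist p1 p0 < \<eta> / 3"
    using \<eta> unfolding closure_approachable by (metis zero_less_divide_iff zero_less_numeral)
  \<comment> \<open>If the plane through \<open>p1\<close> with directions \<open>M1\<close>, moved
    by \<open>t *\<^sub>R v1\<close> for some \<open>t > 0\<close>, meets \<rho>, then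
    \<open>v1\<close> lies in \<open>V \<rho>\<close>. Coning \<rho> from \<open>p1\<close> raises
    its dimension by at most one, so codimension at least two keeps \<open>V \<rho>\<close>
    proper.\<close>
  define V where "V = (\<lambda>\<rho>. {x + y |x y. x \<in> span ((\<lambda>z. - p1 + z) ` \<rho>) \<and> y \<in> M1})"
  define Low where "Low = {\<rho>\<in>C. aff_dim \<rho> < int k - 1}"
  have dimV: "dim W < DIM(real ^ 'n)" if W: "W \<in> V ` Low" for W
  proof -
    obtain \<rho> where \<rho>: "W = V \<rho>" "aff_dim \<rho> < int k - 1" using W by (auto simp: Low_def)
    have "dim ((\<lambda>z. - p1 + z) ` \<rho>) \<le> dim ((\<lambda>z. - p1 + z) ` insert p1 \<rho>)"
      by (intro dim_subset image_mono) auto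
    also have "int \<dots> = aff_dim (insert p1 \<rho>)"
      by (rule aff_dim_eq_dim[symmetric]) (simp add: hull_inc)
    also have "\<dots> < int k" using \<rho>(2) by (simp add: aff_dim_insert)
    finally have "dim (span ((\<lambda>z. - p1 + z) ` \<rho>)) < k" by simp
    then show ?thesis
      using dim_sums_le[OF subspace_span subM1, of "(\<lambda>z. - p1 + z) ` \<rho>"] dimM1
      unfolding \<rho>(1) V_def by simp
  qed
  have "finite (V ` Low)" using fin by (simp add: Low_def)
  then obtain v1 where v1: "dist v1 v0 < \<eta> / 3" "\<And>\<rho>. \<rho> \<in> Low \<Longrightarrow> v1 \<notin> V \<rho>"
    using avoid_subspaces[of "V ` Low" "\<eta> / 3" v0] dimV \<eta> by (metis imageI zero_less_divide_iff zero_less_numeral)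

  \<comment> \<open>The perturbed disk in motion\<close>
  define d0 where "d0 = p0 - c"
  have d0: "d0 \<in> M0" "norm d0 < r"
    using p0 B r(3)[of p0] by (auto simp: d0_def M0_def dist_norm norm_minus_commute)
  \<comment> \<open>The shift by \<open>d0\<close> makes the disk pass through \<open>p1\<close> at
    time 0. Up to time 1 the changes of base point, plane and velocity each cost less than
    \<open>\<eta> / 3\<close>.\<close>
  define \<Phi> where "\<Phi> = (\<lambda>t d. p1 + T (d - d0) + t *\<^sub>R v1)"
  have close: "norm (\<Phi> t d - (c + d + t *\<^sub>R v0)) < \<eta>"
    if d: "d \<in> M0" "norm d \<le> r" and t: "0 \<le> t" "t \<le> 1" for t d
  proof -
    have "norm (d - d0) \<le> 2 * r" using d(2) d0(2) norm_triangle_ineq4[of d d0] by simp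
    then have 1: "norm (T (d - d0) - (d - d0)) < \<eta> / 3"
      using d d0 subM0 by (intro T_close) (auto intro: subspace_diff)
    have "t * norm (v1 - v0) \<le> 1 * norm (v1 - v0)" using t by (intro mult_right_mono) auto
    then have 2: "norm (t *\<^sub>R (v1 - v0)) < \<eta> / 3" using v1(1) t by (simp add: dist_norm)
    have 3: "norm (p1 - p0) < \<eta> / 3" using p1(2) by (simp add: dist_norm)
    have "\<Phi> t d - (c + d + t *\<^sub>R v0) = (p1 - p0) + (T (d - d0) - (d - d0)) + t *\<^sub>R (v1 - v0)"
      by (simp add: \<Phi>_def d0_def algebra_simps)
    also have "norm \<dots> \<le> norm (p1 - p0) + norm (T (d - d0) - (d - d0)) + norm (t *\<^sub>R (v1 - v0))"
      by (rule order_trans[OF norm_triangle_ineq add_right_mono[OF norm_triangle_ineq]])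
    also have "\<dots> < \<eta> / 3 + \<eta> / 3 + \<eta> / 3" by (intro add_strict_mono 1 2 3)
    finally show ?thesis by simp
  qed
  have rim: "\<Phi> t d \<notin> \<Union>C" if d: "d \<in> M0" "norm d = r" and t: "0 \<le> t" "t \<le> 1" for t d
  proof
    assume "\<Phi> t d \<in> \<Union>C"
    from \<eta>1[OF d this] have "\<eta>1 \<le> norm (\<Phi> t d - (c + d))"
      by (simp only: dist_norm norm_minus_commute)
    also have "\<Phi> t d - (c + d) = (\<Phi> t d - (c + d + t *\<^sub>R v0)) + t *\<^sub>R v0" by simp
    also have "norm \<dots> \<le> norm (\<Phi> t d - (c + d + t *\<^sub>R v0)) + norm (t *\<^sub>R v0)" by (rule norm_triangle_ineq)
    also have "\<dots> < \<eta>1 / 2 + \<eta>1 / 2"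
    proof (rule add_strict_mono)
      show "norm (\<Phi> t d - (c + d + t *\<^sub>R v0)) < \<eta>1 / 2" using close[of d t] d t by (simp add: \<eta>_def)
      have "t * norm v0 \<le> 1 * norm v0" using t by (intro mult_right_mono) auto
      then show "norm (t *\<^sub>R v0) < \<eta>1 / 2" using \<epsilon>(1)[folded v0_def] t by simp
    qed
    finally show False by simp
  qed
  have final: "\<Phi> 1 d \<notin> \<Union>C" if d: "d \<in> M0" "norm d \<le> r" for d
  proof
    assume "\<Phi> 1 d \<in> \<Union>C"
    from \<eta>2[OF d this] have "\<eta>2 \<le> norm (\<Phi> 1 d - (c + d + v0))"
      by (simp only: dist_norm norm_minus_commute)
    then show False using close[OF d, of 1] by (simp add: \<eta>_def)
  qed

  \<comment> \<open>Contact times and how to prolong a contact\<close>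
  define Z where "Z = ({0..1} \<times> (M0 \<inter> cball 0 r)) \<inter> (\<lambda>z. \<Phi> (fst z) (snd z)) -` \<Union>C"
  have Z: "(t, d) \<in> Z \<longleftrightarrow> 0 \<le> t \<and> t \<le> 1 \<and> d \<in> M0 \<and> norm d \<le> r \<and> \<Phi> t d \<in> \<Union>C" for t d
    by (auto simp: Z_def)
  have "compact Z"
  proof -
    have "continuous_on UNIV (\<lambda>z::real \<times> (real ^ 'n). \<Phi> (fst z) (snd z))"
      unfolding \<Phi>_def by (intro continuous_intros linear_continuous_on_compose[OF _ linT])
    then have "closed ((\<lambda>z. \<Phi> (fst z) (snd z)) -` \<Union>C)"
      using continuous_closed_preimage[OF _ closed_UNIV closedA] by auto
    then show ?thesis
      unfolding Z_def by (intro compact_Int_closed compact_Times cpt) auto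
  qed
  \<comment> \<open>The component \<open>y\<close> lies along the disk and is absorbed by shifting
    the parameter by \<open>y0\<close>, while \<open>v1\<close> advances time. \<open>rim\<close>
    and \<open>final\<close> leave room for a short move in both.\<close>
  have push: "\<exists>t'>t. t' \<in> fst ` Z"
    if td: "(t, d) \<in> Z" and y: "y \<in> M1" and ev: "\<forall>\<^sub>F s in at_right 0. \<Phi> t d + s *\<^sub>R (v1 + y) \<in> \<Union>C"
    for t d y
  proof -
    obtain y0 where y0: "y0 \<in> M0" "y = T y0" using y by (auto simp: M1_def)
    have Zt: "0 \<le> t" "t \<le> 1" "d \<in> M0" "norm d \<le> r" "\<Phi> t d \<in> \<Union>C"
      using td unfolding Z by blast+
    have "t \<noteq> 1" using final[OF Zt(3,4)] Zt(5) by blast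
    moreover have "norm d \<noteq> r" using rim[OF Zt(3) _ Zt(1,2)] Zt(5) by blast
    ultimately have t: "0 \<le> t" "t < 1" and d: "d \<in> M0" "norm d < r" using Zt by auto
    have "\<forall>\<^sub>F s in at_right (0::real). norm (s *\<^sub>R y0) < r - norm d"
      using d by (intro eventually_scaled_in_ball) simp
    moreover have "\<forall>\<^sub>F s in at_right (0::real). norm (s *\<^sub>R (1::real)) < 1 - t"
      using t by (intro eventually_scaled_in_ball) simp
    ultimately have "\<forall>\<^sub>F s in at_right (0::real). s > 0 \<and> norm (s *\<^sub>R y0) < r - norm d \<and>
        norm (s *\<^sub>R (1::real)) < 1 - t \<and> \<Phi> t d + s *\<^sub>R (v1 + y) \<in> \<Union>C"
      using ev by (intro eventually_conj eventually_at_right_less)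
    then obtain s :: real where s: "s > 0" "norm (s *\<^sub>R y0) < r - norm d"
        "norm (s *\<^sub>R (1::real)) < 1 - t" "\<Phi> t d + s *\<^sub>R (v1 + y) \<in> \<Union>C"
      using eventually_happens'[OF trivial_limit_at_right_real] by blast
    have "T (d + s *\<^sub>R y0 - d0) = T (d - d0) + s *\<^sub>R y"
      using linT y0(2) by (simp add: linear_add linear_diff linear_scale)
    then have "\<Phi> (t + s) (d + s *\<^sub>R y0) = \<Phi> t d + s *\<^sub>R (v1 + y)"
      by (simp add: \<Phi>_def algebra_simps)
    moreover have "d + s *\<^sub>R y0 \<in> M0" using d(1) y0(1) subM0 by (intro subspace_add subspace_scale)
    moreover have "norm (d + s *\<^sub>R y0) \<le> r" using s(2) norm_triangle_ineq[of d "s *\<^sub>R y0"] by linarith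
    ultimately have "(t + s, d + s *\<^sub>R y0) \<in> Z" using s t by (simp add: Z)
    then show ?thesis using s(1) by (intro exI[of _ "t + s"]) force
  qed

  \<comment> \<open>There is no last contact time\<close>
  have start: "\<Phi> 0 d0 = p1" using linear_0[OF linT] by (simp add: \<Phi>_def)
  have "p1 \<in> \<Union>C" using p1(1) rel_interior_subset \<sigma>0(1) by blast
  then have Z0: "(0, d0) \<in> Z" using d0 start by (simp add: Z)
  \<comment> \<open>Genericity of \<open>v1\<close> controls low-dimensional cells at positive times
    only. A first step inside the top-dimensional cell at \<open>p1\<close> ensures that the last
    contact time is positive.\<close>
  have "aff_dim \<sigma>0 \<ge> int k - 1" using \<sigma>0(2) by simp
  from step[OF \<sigma>0(1) p1(1) this, of v1] obtain y
    where "y \<in> M1" "\<forall>\<^sub>F s in at_right 0. \<Phi> 0 d0 + s *\<^sub>R (v1 + y) \<in> \<Union>C"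
    unfolding start by blast
  from push[OF Z0 this] obtain t0 where t0: "t0 > 0" "t0 \<in> fst ` Z" by blast
  have "compact (fst ` Z)" using \<open>compact Z\<close> by (intro compact_continuous_image continuous_intros)
  then obtain t where t: "t \<in> fst ` Z" "\<And>s. s \<in> fst ` Z \<Longrightarrow> s \<le> t"
    using compact_attains_sup[of "fst ` Z"] t0(2) by blast
  then obtain d where td: "(t, d) \<in> Z" by auto
  have tpos: "t > 0" using t0 t(2) by force
  obtain \<tau> where \<tau>: "\<tau> \<in> C" "\<Phi> t d \<in> rel_interior \<tau>"
    using carrier_cell[OF fin complex, of "\<Phi> t d"] td unfolding Z by blast
  \<comment> \<open>On a cell of lower dimension, solving the formula for \<open>\<Phi> t d\<close>
    for \<open>v1\<close>, which divides by \<open>t\<close>, would put \<open>v1\<close> in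
    \<open>V \<tau>\<close>.\<close>
  have "aff_dim \<tau> \<ge> int k - 1"
  proof (rule ccontr)
    assume "\<not> ?thesis"
    then have low: "\<tau> \<in> Low" using \<tau>(1) by (simp add: Low_def)
    have "\<Phi> t d \<in> \<tau>" using \<tau>(2) rel_interior_subset by blast
    then have "(1 / t) *\<^sub>R (- p1 + \<Phi> t d) \<in> span ((\<lambda>z. - p1 + z) ` \<tau>)"
      by (intro span_scale span_base) auto
    moreover have "(- (1 / t)) *\<^sub>R T (d - d0) \<in> M1"
      using td d0(1) subM0 subM1 unfolding M1_def Z
      by (intro subspace_scale imageI subspace_diff) auto
    moreover have "v1 = (1 / t) *\<^sub>R (- p1 + \<Phi> t d) + (- (1 / t)) *\<^sub>R T (d - d0)"
      using tpos by (simp add: \<Phi>_def scaleR_add_right)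
    ultimately have "v1 \<in> V \<tau>" unfolding V_def by blast
    then show False using v1(2)[OF low] by blast
  qed
  from step[OF \<tau> this, of v1] obtain y
    where "y \<in> M1" "\<forall>\<^sub>F s in at_right 0. \<Phi> t d + s *\<^sub>R (v1 + y) \<in> \<Union>C" by blast
  from push[OF td this] obtain t' where "t' > t" "t' \<in> fst ` Z" by blast
  then show False using t(2)[of t'] by simp
qed

end
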